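(* Let $G=(V,E)$ be a finite acyclic directed graph whose edge set is partitioned as $E=E_1\sqcup E_2$ (edges of color 1 and of color 2) and which satisfies (B0): for each $i\in\{1,2\}$, every vertex has at most one entering and at most one leaving edge of color $i$. Then Axioms (B1)--(B2) (for a choice of central elements of $G$) are equivalent to Axioms (B1(i)), (B1(ii)), (B2(i)), (B2(ii)) (for a labeling $\ell:V\to\{0,c,1\}$), under the interpretation of the labels $0,c,1$ as left, central, right. That is: (a) If a set $C$ of central vertices and central 1-edges of $G$ satisfies (B1) and (B2), then the labeling $\ell:V\to\{0,c,1\}$ defined by $\ell(v)=0$ if $v$ is left, $\ell(v)=c$ if $v$ is central, and $\ell(v)=1$ if $v$ is right (with respect to $C$) satisfies (B1(i)), (B1(ii)), (B2(i)), (B2(ii)). (b) Conversely, if a labeling $\ell:V\to\{0,c,1\}$ satisfies (B1(i)), (B1(ii)), (B2(i)), (B2(ii)), then the set $C$ consisting of all vertices $v$ with $\ell(v)=c$ and all 1-edges $(u,v)$ with $(\ell(u),\ell(v))=(0,1)$, taken as the set of central elements, satisfies (B1) and (B2), and with respect to $C$ a vertex $v$ is left, central, or right if and only if $\ell(v)=0$, $\ell(v)=c$, or $\ell(v)=1$, respectively.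
   Context: Edges in $E_i$ are called $i$-edges, for $i=1,2$. Acyclic means having no directed cycles. By (B0), finiteness and acyclicity, each subgraph $(V,E_i)$ is a disjoint union of directed paths (possibly consisting of a single vertex) covering all vertices; these paths are called $i$-strings. Axioms in terms of central elements. Some vertices and some 1-edges of $G$ are distinguished as central; let $C$ be the set of these central elements. (B1) Each 1-string has exactly one central element, which is either a vertex or an edge. When (B1) holds, $V$ is partitioned into central, left and right vertices: a non-central vertex is called left (resp. right) if it lies in its 1-string before (resp. after) the central element of that string; when the central element is an edge $(u,v)$, its beginning vertex $u$ is regarded as left and its end vertex $v$ as right. (B2) Each 2-string $P$ contains exactly one central vertex $v$; moreover, all vertices of $P$ lying before $v$ are right, and all vertices of $P$ lying after $v$ are left. Axioms in terms of labels. Let $\ell:V\to\{0,c,1\}$ be a labeling of the vertices, where $0,c,1$ are three distinct symbols. (B1(i)) For each 1-edge $(u,v)$, the pair $(\ell(u),\ell(v))$ is one of $(0,0),(0,c),(0,1),(c,1),(1,1)$. (B1(ii)) If a vertex $v$ has no entering 1-edge, then $\ell(v)\ne 1$; and if a vertex $v$ has no leaving 1-edge, then $\ell(v)\ne 0$. (B2(i)) For each 2-edge $(u,v)$, the pair $(\ell(u),\ell(v))$ is one of $(1,1),(1,c),(c,0),(0,0)$. (B2(ii)) If a vertex $v$ has no entering 2-edge, then $\ell(v)\ne 0$; and if a vertex $v$ has no leaving 2-edge, then $\ell(v)\ne 1$. *)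

theory Defs
  imports "Graph_Theory.Graph_Theory"
begin

definition colour_subgraph :: "('a,'b) pre_digraph \<Rightarrow> 'b set \<Rightarrow> ('a,'b) pre_digraph" where
  "colour_subgraph G F = G\<lparr>arcs := F\<rparr>"

definition B0 :: "('a,'b) pre_digraph \<Rightarrow> 'b set \<Rightarrow> bool" where
  "B0 G F \<longleftrightarrow> (\<forall>v\<in>verts G.
     in_degree (colour_subgraph G F) v \<le> 1 \<and> out_degree (colour_subgraph G F) v \<le> 1)"

text \<open>The vertices and edges of a path, in the order in which the path traverses them; vertices
  are tagged by \<^const>\<open>Inl\<close>, edges by \<^const>\<open>Inr\<close>.\<close>

fun path_elems :: "('a,'b) pre_digraph \<Rightarrow> 'a \<Rightarrow> 'b awalk \<Rightarrow> ('a + 'b) list" where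
  "path_elems G u [] = [Inl u]"
| "path_elems G u (e # p) = Inl u # Inr e # path_elems G (head G e) p"

text \<open>If every vertex has at most one entering and at most one leaving edge in \<open>F\<close> and there are
  no cycles, the components of \<open>(V, F)\<close> are exactly the paths that cannot be extended at either
  end.\<close>

definition strings :: "('a,'b) pre_digraph \<Rightarrow> 'b set \<Rightarrow> ('a + 'b) list set" where
  "strings G F = {path_elems G u p | u p v.
     pre_digraph.apath (colour_subgraph G F) u p v \<and>
     in_arcs (colour_subgraph G F) u = {} \<and> out_arcs (colour_subgraph G F) v = {}}"

definition lies_before :: "'c list \<Rightarrow> 'c \<Rightarrow> 'c \<Rightarrow> bool" where
  "lies_before xs y z \<longleftrightarrow> (\<exists>i j. i < j \<and> j < length xs \<and> xs ! i = y \<and> xs ! j = z)"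

definition B1 :: "('a,'b) pre_digraph \<Rightarrow> 'b set \<Rightarrow> ('a + 'b) set \<Rightarrow> bool" where
  "B1 G E1 C \<longleftrightarrow> (\<forall>P\<in>strings G E1. \<exists>!z. z \<in> set P \<and> z \<in> C)"

definition central_vertex :: "('a,'b) pre_digraph \<Rightarrow> ('a + 'b) set \<Rightarrow> 'a \<Rightarrow> bool" where
  "central_vertex G C v \<longleftrightarrow> v \<in> verts G \<and> Inl v \<in> C"

text \<open>The beginning (end) vertex of an edge precedes (follows) that edge in the list given by
  \<^const>\<open>path_elems\<close>, so for a central edge it is left (right).\<close>

definition left_vertex :: "('a,'b) pre_digraph \<Rightarrow> 'b set \<Rightarrow> ('a + 'b) set \<Rightarrow> 'a \<Rightarrow> bool" where
  "left_vertex G E1 C v \<longleftrightarrow> v \<in> verts G \<and> Inl v \<notin> C \<and>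
     (\<exists>P\<in>strings G E1. \<exists>z\<in>C. lies_before P (Inl v) z)"

definition right_vertex :: "('a,'b) pre_digraph \<Rightarrow> 'b set \<Rightarrow> ('a + 'b) set \<Rightarrow> 'a \<Rightarrow> bool" where
  "right_vertex G E1 C v \<longleftrightarrow> v \<in> verts G \<and> Inl v \<notin> C \<and>
     (\<exists>P\<in>strings G E1. \<exists>z\<in>C. lies_before P z (Inl v))"

definition B2 ::
  "('a,'b) pre_digraph \<Rightarrow> 'b set \<Rightarrow> 'b set \<Rightarrow> ('a + 'b) set \<Rightarrow> bool" where
  "B2 G E1 E2 C \<longleftrightarrow> (\<forall>P\<in>strings G E2. \<exists>v.
     {w. Inl w \<in> set P \<and> central_vertex G C w} = {v} \<and>
     (\<forall>w. lies_before P (Inl w) (Inl v) \<longrightarrow> right_vertex G E1 C w) \<and>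
     (\<forall>w. lies_before P (Inl v) (Inl w) \<longrightarrow> left_vertex G E1 C w))"

datatype label = L0 | Lc | L1

definition B1_i :: "('a,'b) pre_digraph \<Rightarrow> 'b set \<Rightarrow> ('a \<Rightarrow> label) \<Rightarrow> bool" where
  "B1_i G E1 l \<longleftrightarrow> (\<forall>e\<in>E1. (l (tail G e), l (head G e)) \<in>
     {(L0, L0), (L0, Lc), (L0, L1), (Lc, L1), (L1, L1)})"

definition B1_ii :: "('a,'b) pre_digraph \<Rightarrow> 'b set \<Rightarrow> ('a \<Rightarrow> label) \<Rightarrow> bool" where
  "B1_ii G E1 l \<longleftrightarrow> (\<forall>v\<in>verts G.
     (in_arcs (colour_subgraph G E1) v = {} \<longrightarrow> l v \<noteq> L1) \<and>
     (out_arcs (colour_subgraph G E1) v = {} \<longrightarrow> l v \<noteq> L0))"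

definition B2_i :: "('a,'b) pre_digraph \<Rightarrow> 'b set \<Rightarrow> ('a \<Rightarrow> label) \<Rightarrow> bool" where
  "B2_i G E2 l \<longleftrightarrow> (\<forall>e\<in>E2. (l (tail G e), l (head G e)) \<in>
     {(L1, L1), (L1, Lc), (Lc, L0), (L0, L0)})"

definition B2_ii :: "('a,'b) pre_digraph \<Rightarrow> 'b set \<Rightarrow> ('a \<Rightarrow> label) \<Rightarrow> bool" where
  "B2_ii G E2 l \<longleftrightarrow> (\<forall>v\<in>verts G.
     (in_arcs (colour_subgraph G E2) v = {} \<longrightarrow> l v \<noteq> L0) \<and>
     (out_arcs (colour_subgraph G E2) v = {} \<longrightarrow> l v \<noteq> L1))"

definition label_axioms ::
  "('a,'b) pre_digraph \<Rightarrow> 'b set \<Rightarrow> 'b set \<Rightarrow> ('a \<Rightarrow> label) \<Rightarrow> bool" where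
  "label_axioms G E1 E2 l \<longleftrightarrow> B1_i G E1 l \<and> B1_ii G E1 l \<and> B2_i G E2 l \<and> B2_ii G E2 l"

definition labels_agree ::
  "('a,'b) pre_digraph \<Rightarrow> 'b set \<Rightarrow> ('a + 'b) set \<Rightarrow> ('a \<Rightarrow> label) \<Rightarrow> bool" where
  "labels_agree G E1 C l \<longleftrightarrow> (\<forall>v\<in>verts G.
     (left_vertex G E1 C v \<longleftrightarrow> l v = L0) \<and>
     (central_vertex G C v \<longleftrightarrow> l v = Lc) \<and>
     (right_vertex G E1 C v \<longleftrightarrow> l v = L1))"

definition central_elements ::
  "('a,'b) pre_digraph \<Rightarrow> 'b set \<Rightarrow> ('a \<Rightarrow> label) \<Rightarrow> ('a + 'b) set" where
  "central_elements G E1 l =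
     {v \<in> verts G. l v = Lc} <+> {e \<in> E1. l (tail G e) = L0 \<and> l (head G e) = L1}"

end

theory Submission
  imports Defs
begin

text \<open>Everything happens along single strings, so the first task is to show that the strings of a
  colour behave like the disjoint paths of the informal picture. In a finite acyclic graph every
  walk is a path and has bounded length, so a longest walk extending a given one cannot be
  prolonged at either end and is a string; hence every vertex and every edge lies on a string
  (\<open>string_through_vertex\<close>, \<open>string_through_edge\<close>). Since degrees are at most one, a walk
  can be continued or traced back in only one way, so two strings with a common element coincide
  (\<open>strings_meeting_eq\<close>), and they have no repeated elements.

  If central elements are given, a vertex of a 1-string is left or right according to whether the
  unique central element of the string comes after or before it (\<open>left_vertex_iff\<close>,
  \<open>right_vertex_iff\<close>). The label axioms then follow by asking where the central element sits
  relative to the two ends of an edge, or to a vertex at the end of a string.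

  If a labeling is given, the local axioms force the labels along a string to run through one
  block, then a single switch, then the other block: 0 to 1 along a 1-string, 1 to 0 along a
  2-string (\<open>string_two_phases\<close>). The end conditions say that the switch really occurs. It is the
  only vertex labelled c or, when a 1-string jumps from 0 to 1, the edge of the jump. In a 2-string
  no jump is possible, so the switch is a vertex; this is the central element demanded by the
  axioms, and the blocks are its two sides.\<close>

section \<open>Relative position in a list\<close>

text \<open>Order on a string is easier to handle by splitting the list than by comparing indices.\<close>

lemma lies_before_iff_split:
  "lies_before zs x y \<longleftrightarrow> (\<exists>as bs cs. zs = as @ x # bs @ y # cs)"
proof
  assume "lies_before zs x y"
  then obtain i j where ij: "i < j" "j < length zs" "zs ! i = x" "zs ! j = y"
    by (auto simp: lies_before_def)
  define us where "us = drop (Suc i) zs"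
  have "zs = take i zs @ x # us"
    using ij id_take_nth_drop[of i zs] by (simp add: us_def)
  moreover have "us = take (j - Suc i) us @ y # drop (Suc (j - Suc i)) us"
    using ij id_take_nth_drop[of "j - Suc i" us] by (simp add: us_def)
  ultimately show "\<exists>as bs cs. zs = as @ x # bs @ y # cs"
    by metis
next
  assume "\<exists>as bs cs. zs = as @ x # bs @ y # cs"
  then obtain as bs cs where zs: "zs = as @ x # bs @ y # cs" by blast
  have "length as < length as + Suc (length bs)"
    "length as + Suc (length bs) < length zs"
    "zs ! length as = x" "zs ! (length as + Suc (length bs)) = y"
    using zs by (simp_all add: nth_append)
  then show "lies_before zs x y" unfolding lies_before_def by blast
qed

lemma lies_before_set: "lies_before zs x y \<Longrightarrow> x \<in> set zs \<and> y \<in> set zs"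
  by (auto simp: lies_before_iff_split)

lemma lies_before_pivot_right:
  assumes "distinct (xs @ z # ys)"
  shows "lies_before (xs @ z # ys) z y \<longleftrightarrow> y \<in> set ys"
proof
  assume "lies_before (xs @ z # ys) z y"
  then obtain as bs cs where "xs @ z # ys = as @ z # bs @ y # cs"
    by (auto simp: lies_before_iff_split)
  then have "ys = bs @ y # cs"
    using assms by (subst (asm) append_Cons_eq_iff) auto
  then show "y \<in> set ys" by simp
next
  assume "y \<in> set ys"
  then show "lies_before (xs @ z # ys) z y"
    by (fastforce simp: lies_before_iff_split dest: split_list)
qed

lemma lies_before_pivot_left:
  assumes "distinct (xs @ z # ys)"
  shows "lies_before (xs @ z # ys) y z \<longleftrightarrow> y \<in> set xs"
proof
  assume "lies_before (xs @ z # ys) y z"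
  then obtain as bs cs where "xs @ z # ys = (as @ y # bs) @ z # cs"
    by (auto simp: lies_before_iff_split)
  then have "xs = as @ y # bs"
    using assms by (subst (asm) append_Cons_eq_iff) auto
  then show "y \<in> set xs" by simp
next
  assume "y \<in> set xs"
  then obtain as bs where "xs = as @ y # bs" by (auto dest: split_list)
  then have "xs @ z # ys = as @ y # bs @ z # ys" by simp
  then show "lies_before (xs @ z # ys) y z"
    unfolding lies_before_iff_split by blast
qed

section \<open>Strings of one colour\<close>

lemma colour_subgraph_simps [simp]:
  "verts (colour_subgraph G F) = verts G" "arcs (colour_subgraph G F) = F"
  "tail (colour_subgraph G F) = tail G" "head (colour_subgraph G F) = head G"
  by (simp_all add: colour_subgraph_def)

locale colour_class = fin_digraph G for G :: "('a, 'b) pre_digraph" (structure) +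
  fixes F :: "'b set"
  assumes colour_arcs: "F \<subseteq> arcs G"
    and acyclic: "\<nexists>p. cycle p"
    and linear: "B0 G F"
begin

abbreviation "H \<equiv> colour_subgraph G F"

sublocale H: fin_digraph H
  using colour_arcs by unfold_locales (auto intro: finite_subset)

lemma leaving_edge_unique:
  assumes "e \<in> F" "e' \<in> F" "tail G e = tail G e'"
  shows "e = e'"
proof -
  have "card (out_arcs H (tail G e)) \<le> Suc 0"
    using linear assms colour_arcs by (auto simp: B0_def out_degree_def)
  then show ?thesis
    using assms H.finite_out_arcs by (subst (asm) card_le_Suc0_iff_eq) auto
qed

lemma entering_edge_unique:
  assumes "e \<in> F" "e' \<in> F" "head G e = head G e'"
  shows "e = e'"
proof -
  have "card (in_arcs H (head G e)) \<le> Suc 0"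
    using linear assms colour_arcs by (auto simp: B0_def in_degree_def)
  then show ?thesis
    using assms H.finite_in_arcs by (subst (asm) card_le_Suc0_iff_eq) auto
qed

text \<open>A repeated vertex would close up a cycle.\<close>

lemma walk_is_path:
  assumes "H.awalk u p v"
  shows "H.apath u p v"
proof (rule ccontr)
  assume "\<not> H.apath u p v"
  then obtain w r where "H.awalk w r w" "r \<noteq> []"
    using H.awalk_not_distinct_decomp[OF assms] assms by (auto simp: H.apath_def)
  then obtain q where "H.cycle q"
    using H.closed_w_imp_cycle by (auto simp: H.closed_w_def)
  moreover have "subgraph H G"
    using colour_arcs wf_digraph H.wf_digraph by (auto simp: subgraph_def compatible_def)
  ultimately show False
    using subgraph_cycle acyclic by blast
qed

text \<open>Walks around \<open>q\<close> are paths, hence of bounded length; the longest one has no room at either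
  end. Taking \<open>q\<close> empty or a single edge yields the strings through a vertex or an edge.\<close>

lemma walk_extends_to_maximal:
  assumes "H.awalk a q b"
  obtains u p1 p2 v where "H.awalk u p1 a" "H.awalk b p2 v" "H.apath u (p1 @ q @ p2) v"
    "in_arcs H u = {}" "out_arcs H v = {}"
proof -
  \<comment> \<open>The possible lengths of walks that extend \<open>q\<close>.\<close>
  define ext where "ext = (\<lambda>n. \<exists>u p1 p2 v. H.awalk u p1 a \<and> H.awalk b p2 v \<and>
    n = length p1 + length q + length p2)"
  have bound: "n < card (verts H)" if "ext n" for n
  proof -
    from that obtain u p1 p2 v where w: "H.awalk u p1 a" "H.awalk b p2 v"
      "n = length p1 + length q + length p2" unfolding ext_def by blast
    have "H.awalk u (p1 @ q @ p2) v"
      using w assms by (intro H.awalk_appendI)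
    from H.length_apath_less[OF walk_is_path[OF this]] w(3) show ?thesis by simp
  qed
  have "ext (length q)"
    unfolding ext_def using assms
    by (auto intro!: exI[of _ a] exI[of _ "[]"] exI[of _ b] simp: H.awalk_Nil_iff)
  from ex_has_greatest_nat[of ext, OF this, of id "card (verts H)"] bound
  obtain n where n: "ext n" "\<And>m. ext m \<Longrightarrow> m \<le> n"
    using less_imp_le by auto
  then obtain u p1 p2 v where w: "H.awalk u p1 a" "H.awalk b p2 v"
      "n = length p1 + length q + length p2" unfolding ext_def by blast
  have "in_arcs H u = {}"
  proof (rule ccontr)
    assume "in_arcs H u \<noteq> {}"
    then obtain e where "e \<in> in_arcs H u" by blast
    then have "e \<in> F" "head G e = u" by simp_all
    then have "H.awalk (tail G e) (e # p1) a" using w by (simp add: H.awalk_Cons_iff)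
    then have "ext (Suc n)" unfolding ext_def using w
      by (intro exI[of _ "tail G e"] exI[of _ "e # p1"] exI[of _ p2] exI[of _ v]) simp
    from n(2)[OF this] show False by simp
  qed
  moreover have "out_arcs H v = {}"
  proof (rule ccontr)
    assume "out_arcs H v \<noteq> {}"
    then obtain e where "e \<in> out_arcs H v" by blast
    then have e: "e \<in> F" "tail G e = v" by simp_all
    then have "H.awalk b (p2 @ [e]) (head G e)"
      using w H.arc_implies_awalk[of e] by (intro H.awalk_appendI[OF w(2)]) auto
    then have "ext (Suc n)" unfolding ext_def using w
      by (intro exI[of _ u] exI[of _ p1] exI[of _ "p2 @ [e]"] exI[of _ "head G e"]) simp
    from n(2)[OF this] show False by simp
  qed
  moreover have "H.apath u (p1 @ q @ p2) v"
    using w assms by (intro walk_is_path H.awalk_appendI)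
  ultimately show thesis using that w by blast
qed

text \<open>Reading forwards, each edge is forced, and a walk can stop in a sink only.\<close>

lemma walk_to_sink_unique:
  assumes "H.awalk a p v" "out_arcs H v = {}" "H.awalk a q w" "out_arcs H w = {}"
  shows "p = q"
  using assms
proof (induction p arbitrary: a q)
  case Nil
  then show ?case by (cases q) (auto simp: H.awalk_simps)
next
  case (Cons e p)
  then obtain e' q' where q: "q = e' # q'" by (cases q) (auto simp: H.awalk_simps)
  with Cons.prems have "e = e'" by (auto simp: H.awalk_simps intro: leaving_edge_unique)
  with Cons q show ?case by (auto simp: H.awalk_simps)
qed

lemma walk_from_source_unique:
  assumes "H.awalk u p b" "in_arcs H u = {}" "H.awalk w q b" "in_arcs H w = {}"
  shows "u = w \<and> p = q"
  using assms
proof (induction p arbitrary: b q rule: rev_induct)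
  case Nil
  then show ?case by (cases q rule: rev_cases) (auto simp: H.awalk_simps)
next
  case (snoc e p)
  then obtain e' q' where q: "q = q' @ [e']"
    by (cases q rule: rev_cases) (auto simp: H.awalk_simps)
  with snoc.prems have ee: "e = e'" by (auto simp: H.awalk_simps intro: entering_edge_unique)
  have "H.awalk u p (tail G e)" "H.awalk w q' (tail G e)"
    using snoc.prems q ee by (auto simp: H.awalk_simps)
  from snoc.IH[OF this(1) snoc.prems(2) this(2) snoc.prems(4)] show ?case
    using q ee by simp
qed

lemma stringE:
  assumes "P \<in> strings G F"
  obtains u p v where "P = path_elems G u p" "H.apath u p v" "H.awalk u p v"
    "in_arcs H u = {}" "out_arcs H v = {}"
  using assms by (auto simp: strings_def H.apath_def)

lemma stringI:
  "H.apath u p v \<Longrightarrow> in_arcs H u = {} \<Longrightarrow> out_arcs H v = {} \<Longrightarrow> path_elems G u p \<in> strings G F"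
  by (auto simp: strings_def)

lemma path_elems_append:
  "H.awalk u p v \<Longrightarrow> path_elems G u (p @ q) =
     concat (map (\<lambda>e. [Inl (tail G e), Inr e]) p) @ path_elems G v q"
  by (induction p arbitrary: u) (auto simp: H.awalk_simps)

lemma path_elems_start: "\<exists>ys. path_elems G u p = Inl u # ys \<and> (p = [] \<longrightarrow> ys = [])"
  by (cases p) auto

lemma set_path_elems:
  "H.awalk u p v \<Longrightarrow> set (path_elems G u p) = Inl ` set (H.awalk_verts u p) \<union> Inr ` set p"
  by (induction p arbitrary: u) (auto simp: H.awalk_simps)

lemma string_vertex:
  assumes "P \<in> strings G F" "Inl v \<in> set P"
  shows "v \<in> verts G"
proof -
  obtain u p w where P: "P = path_elems G u p" "H.awalk u p w"
    using assms(1) by (elim stringE)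
  have "set (H.awalk_verts u p) \<subseteq> verts G"
    using P(2) by (rule H.awalkE') simp
  then show ?thesis using assms(2) P by (auto simp: set_path_elems)
qed

lemma string_edge:
  assumes "P \<in> strings G F" "Inr e \<in> set P"
  shows "e \<in> F"
proof -
  obtain u p w where P: "P = path_elems G u p" "H.awalk u p w"
    using assms(1) by (elim stringE)
  have "set p \<subseteq> F"
    using P(2) by (rule H.awalkE') simp
  then show ?thesis using assms(2) P by (auto simp: set_path_elems)
qed

lemma distinct_path_elems: "H.apath u p v \<Longrightarrow> distinct (path_elems G u p)"
proof (induction p arbitrary: u)
  case (Cons e p)
  then have p: "H.apath (head G e) p v" "tail G e = u" "u \<notin> set (H.awalk_verts (head G e) p)"
    by (auto simp: H.apath_simps)
  moreover have "set (path_elems G (head G e) p) =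
      Inl ` set (H.awalk_verts (head G e) p) \<union> Inr ` set p"
    using p(1) set_path_elems by (auto simp: H.apath_def)
  moreover have "e \<notin> set p"
    using p H.awalk_verts_arc1[of e p] by auto
  ultimately show ?case using Cons.IH[of "head G e"] by auto
qed simp

lemma distinct_string: "P \<in> strings G F \<Longrightarrow> distinct P"
  by (erule stringE) (auto intro: distinct_path_elems)

text \<open>The last two conclusions record that an extremal vertex is an end of its string, because no
  non-empty walk ends in a source or begins in a sink.\<close>

lemma string_through_vertex:
  assumes "v \<in> verts G"
  obtains xs ys where "xs @ Inl v # ys \<in> strings G F"
    "in_arcs H v = {} \<Longrightarrow> xs = []" "out_arcs H v = {} \<Longrightarrow> ys = []"
proof -
  have nil: "H.awalk v [] v" using assms by (simp add: H.awalk_Nil_iff)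
  obtain u p1 p2 w where
    w: "H.awalk u p1 v" "H.awalk v p2 w" "H.apath u (p1 @ [] @ p2) w"
      "in_arcs H u = {}" "out_arcs H w = {}"
    by (rule walk_extends_to_maximal[OF nil])
  from path_elems_start[of v p2] obtain ys where
    ys: "path_elems G v p2 = Inl v # ys" "p2 = [] \<longrightarrow> ys = []" by blast
  have "concat (map (\<lambda>e. [Inl (tail G e), Inr e]) p1) @ Inl v # ys \<in> strings G F"
    using stringI[OF w(3-5)] path_elems_append[OF w(1), of p2] ys(1) by simp
  moreover have "p1 = []" if "in_arcs H v = {}"
    using walk_from_source_unique[OF w(1,4) nil that] by simp
  moreover have "p2 = []" if "out_arcs H v = {}"
    using walk_to_sink_unique[OF w(2,5) nil that] .
  ultimately show thesis
    using ys(2) by (intro that[of "concat (map (\<lambda>e. [Inl (tail G e), Inr e]) p1)" ys]) auto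
qed

lemma string_through_edge:
  assumes "e \<in> F"
  obtains xs ys where "xs @ Inl (tail G e) # Inr e # Inl (head G e) # ys \<in> strings G F"
proof -
  have walk: "H.awalk (tail G e) [e] (head G e)" using assms H.arc_implies_awalk[of e] by simp
  obtain u p1 p2 w where
    w: "H.awalk u p1 (tail G e)" "H.apath u (p1 @ [e] @ p2) w"
      "in_arcs H u = {}" "out_arcs H w = {}"
    by (rule walk_extends_to_maximal[OF walk])
  from path_elems_start[of "head G e" p2] obtain ys where
    "path_elems G (head G e) p2 = Inl (head G e) # ys" by blast
  then show thesis
    using that stringI[OF w(2-4)] path_elems_append[OF w(1), of "e # p2"] by simp
qed

text \<open>Cut both strings at the common vertex: the initial parts agree by tracing back to the source, the
  final parts by following to the sink.\<close>

lemma strings_meeting_in_vertex_eq: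
  assumes "P \<in> strings G F" "Q \<in> strings G F" "Inl x \<in> set P" "Inl x \<in> set Q"
  shows "P = Q"
proof -
  obtain u p v where P: "P = path_elems G u p" "H.awalk u p v"
    "in_arcs H u = {}" "out_arcs H v = {}" using assms(1) by (elim stringE)
  obtain u' q v' where Q: "Q = path_elems G u' q" "H.awalk u' q v'"
    "in_arcs H u' = {}" "out_arcs H v' = {}" using assms(2) by (elim stringE)
  have "x \<in> set (H.awalk_verts u p)" "x \<in> set (H.awalk_verts u' q)"
    using P Q assms(3,4) by (auto simp: set_path_elems)
  then obtain p1 p2 q1 q2 where
    p: "p = p1 @ p2" "H.awalk u p1 x" "H.awalk x p2 v" and
    q: "q = q1 @ q2" "H.awalk u' q1 x" "H.awalk x q2 v'"
    using H.awalk_decomp[OF P(2)] H.awalk_decomp[OF Q(2)] by metis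
  have "u = u' \<and> p1 = q1" using walk_from_source_unique p(2) P(3) q(2) Q(3) .
  moreover have "p2 = q2" using walk_to_sink_unique p(3) P(4) q(3) Q(4) .
  ultimately show ?thesis using P Q p q by simp
qed

lemma path_elems_tail:
  "H.awalk u p v \<Longrightarrow> Inr e \<in> set (path_elems G u p) \<Longrightarrow> Inl (tail G e) \<in> set (path_elems G u p)"
  using H.awalk_verts_arc1[of e p u] by (auto simp: set_path_elems)

lemma strings_meeting_eq:
  assumes "P \<in> strings G F" "Q \<in> strings G F" "x \<in> set P" "x \<in> set Q"
  shows "P = Q"
proof (cases x)
  case (Inl v)
  then show ?thesis using assms strings_meeting_in_vertex_eq by blast
next
  case (Inr e)
  have "Inl (tail G e) \<in> set P" "Inl (tail G e) \<in> set Q"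
    using assms Inr path_elems_tail by (auto elim!: stringE)
  then show ?thesis using assms strings_meeting_in_vertex_eq by blast
qed

lemma path_constant_phase:
  assumes "H.awalk u p v" "f (Inl u) = y"
    and "\<And>e. e \<in> F \<Longrightarrow> f (Inl (tail G e)) = y \<Longrightarrow> f (Inr e) = y \<and> f (Inl (head G e)) = y"
    and "t \<in> set (path_elems G u p)"
  shows "f t = y"
  using assms(1,2,4) by (induction p arbitrary: u) (auto simp: H.awalk_simps dest: assms(3))

text \<open>The labels \<open>x\<close>, \<open>c\<close>, \<open>y\<close> are those of the elements before, at and after the switch. Edges are
  labelled as well, so that a jump from an \<open>x\<close>-vertex to a \<open>y\<close>-vertex places the switch on the edge.
  The switch occurs since the path can neither begin with \<open>y\<close> nor end with \<open>x\<close>, and it occurs once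
  since \<open>y\<close> persists after it.\<close>

lemma path_two_phases:
  assumes "H.awalk u p v" "f (Inl u) \<in> {x, c}" "f (Inl v) \<in> {c, y}" "x \<noteq> c" "x \<noteq> y" "c \<noteq> y"
    and "\<And>e. e \<in> F \<Longrightarrow> (f (Inl (tail G e)), f (Inr e), f (Inl (head G e)))
            \<in> {(x, x, x), (x, x, c), (x, c, y), (c, y, y), (y, y, y)}"
  shows "\<exists>xs z ys. path_elems G u p = xs @ z # ys \<and>
    (\<forall>t\<in>set xs. f t = x) \<and> f z = c \<and> (\<forall>t\<in>set ys. f t = y)"
  using assms(1,2)
proof (induction p arbitrary: u)
  case Nil
  then have "f (Inl u) = c" using assms(3-6) by (auto simp: H.awalk_simps)
  then show ?case by (intro exI[of _ "[]"] exI[of _ "Inl u"]) simp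
next
  case (Cons e p)
  have e: "e \<in> F" "tail G e = u" "H.awalk (head G e) p v"
    using Cons.prems(1) by (auto simp: H.awalk_simps)
  have later: "f t = y" if "f (Inl (head G e)) = y" "t \<in> set (path_elems G (head G e) p)" for t
    using path_constant_phase[OF e(3), of f y t] that assms(4-7) by force
  have step: "(f (Inl u), f (Inr e), f (Inl (head G e)))
      \<in> {(x, x, x), (x, x, c), (x, c, y), (c, y, y)}"
    using assms(7)[OF e(1)] e(2) Cons.prems(2) assms(4-6) by auto
  consider (before) "f (Inl u) = x" "f (Inr e) = x" "f (Inl (head G e)) \<in> {x, c}"
    | (edge) "f (Inl u) = x" "f (Inr e) = c" "f (Inl (head G e)) = y"
    | (vertex) "f (Inl u) = c" "f (Inr e) = y" "f (Inl (head G e)) = y"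
    using step by auto
  then show ?case
  proof cases
    case before
    from Cons.IH[OF e(3) before(3)] obtain xs z ys where
      "path_elems G (head G e) p = xs @ z # ys" "\<forall>t\<in>set xs. f t = x" "f z = c"
      "\<forall>t\<in>set ys. f t = y" by blast
    then show ?thesis using before
      by (intro exI[of _ "Inl u # Inr e # xs"] exI[of _ z] exI[of _ ys]) simp
  next
    case edge
    then show ?thesis using later
      by (intro exI[of _ "[Inl u]"] exI[of _ "Inr e"]
          exI[of _ "path_elems G (head G e) p"]) simp
  next
    case vertex
    then show ?thesis using later
      by (intro exI[of _ "[]"] exI[of _ "Inl u"]
          exI[of _ "Inr e # path_elems G (head G e) p"]) auto
  qed
qed

lemma string_two_phases:
  assumes "P \<in> strings G F" "x \<noteq> c" "x \<noteq> y" "c \<noteq> y"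
    and "\<And>v. v \<in> verts G \<Longrightarrow> in_arcs H v = {} \<Longrightarrow> f (Inl v) \<in> {x, c}"
    and "\<And>v. v \<in> verts G \<Longrightarrow> out_arcs H v = {} \<Longrightarrow> f (Inl v) \<in> {c, y}"
    and "\<And>e. e \<in> F \<Longrightarrow> (f (Inl (tail G e)), f (Inr e), f (Inl (head G e)))
            \<in> {(x, x, x), (x, x, c), (x, c, y), (c, y, y), (y, y, y)}"
  obtains xs z ys where "P = xs @ z # ys"
    "\<forall>t\<in>set xs. f t = x" "f z = c" "\<forall>t\<in>set ys. f t = y"
proof -
  obtain u p v where P: "P = path_elems G u p" "H.awalk u p v"
    "in_arcs H u = {}" "out_arcs H v = {}" using assms(1) by (elim stringE)
  have "u \<in> verts G" "v \<in> verts G" using P(2) by auto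
  then have "f (Inl u) \<in> {x, c}" "f (Inl v) \<in> {c, y}" using assms(5,6) P by auto
  from path_two_phases[of u p v f x c y, OF P(2) this assms(2-4,7)] show thesis
    using that P(1) by metis
qed

end

section \<open>From central elements to labels\<close>

locale two_coloured = c1: colour_class G E1 + c2: colour_class G E2
  for G :: "('a, 'b) pre_digraph" and E1 E2 :: "'b set"
begin

lemma central_in_string_unique:
  assumes "B1 G E1 C" "P \<in> strings G E1" "z \<in> set P" "z \<in> C" "z' \<in> set P" "z' \<in> C"
  shows "z = z'"
  using assms unfolding B1_def by metis

text \<open>The defining condition quantifies over all strings and all central elements; by uniqueness of the
  string through \<open>v\<close> and of its central element it can be read off from any one splitting.\<close>

lemma left_vertex_iff:
  assumes "B1 G E1 C" "xs @ Inl v # ys \<in> strings G E1"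
  shows "left_vertex G E1 C v \<longleftrightarrow> (\<exists>z\<in>set ys. z \<in> C)"
proof -
  let ?P = "xs @ Inl v # ys"
  have d: "distinct ?P" using c1.distinct_string assms by blast
  have v: "v \<in> verts G" using c1.string_vertex[OF assms(2)] by simp
  have "left_vertex G E1 C v \<longleftrightarrow> Inl v \<notin> C \<and> (\<exists>z\<in>C. lies_before ?P (Inl v) z)"
  proof -
    have "Q = ?P" if "Q \<in> strings G E1" "lies_before Q (Inl v) z" for Q z
      using c1.strings_meeting_eq[OF that(1) assms(2), of "Inl v"] lies_before_set[OF that(2)] by simp
    then show ?thesis using v assms(2) unfolding left_vertex_def by metis
  qed
  also have "\<dots> \<longleftrightarrow> (\<exists>z\<in>set ys. z \<in> C)"
    using central_in_string_unique[OF assms, of "Inl v"] d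
    by (auto simp: lies_before_pivot_right[OF d])
  finally show ?thesis .
qed

lemma right_vertex_iff:
  assumes "B1 G E1 C" "xs @ Inl v # ys \<in> strings G E1"
  shows "right_vertex G E1 C v \<longleftrightarrow> (\<exists>z\<in>set xs. z \<in> C)"
proof -
  let ?P = "xs @ Inl v # ys"
  have d: "distinct ?P" using c1.distinct_string assms by blast
  have v: "v \<in> verts G" using c1.string_vertex[OF assms(2)] by simp
  have "right_vertex G E1 C v \<longleftrightarrow> Inl v \<notin> C \<and> (\<exists>z\<in>C. lies_before ?P z (Inl v))"
  proof -
    have "Q = ?P" if "Q \<in> strings G E1" "lies_before Q z (Inl v)" for Q z
      using c1.strings_meeting_eq[OF that(1) assms(2), of "Inl v"] lies_before_set[OF that(2)] by simp
    then show ?thesis using v assms(2) unfolding right_vertex_def by metis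
  qed
  also have "\<dots> \<longleftrightarrow> (\<exists>z\<in>set xs. z \<in> C)"
    using central_in_string_unique[OF assms, of "Inl v"] d
    by (auto simp: lies_before_pivot_left[OF d])
  finally show ?thesis .
qed

text \<open>The central element of the string of \<open>v\<close> is before, at or after \<open>v\<close>, and it is only one of these.\<close>

lemma vertex_trichotomy:
  assumes "B1 G E1 C" "v \<in> verts G"
  shows "left_vertex G E1 C v \<or> central_vertex G C v \<or> right_vertex G E1 C v"
    and "\<not> (left_vertex G E1 C v \<and> right_vertex G E1 C v)"
proof -
  obtain xs ys where P: "xs @ Inl v # ys \<in> strings G E1"
    using c1.string_through_vertex[OF assms(2)] by blast
  have "\<exists>z\<in>set (xs @ Inl v # ys). z \<in> C" using assms(1) P unfolding B1_def by blast
  then show "left_vertex G E1 C v \<or> central_vertex G C v \<or> right_vertex G E1 C v"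
    using left_vertex_iff[OF assms(1) P] right_vertex_iff[OF assms(1) P] assms(2)
    by (auto simp: central_vertex_def)
  show "\<not> (left_vertex G E1 C v \<and> right_vertex G E1 C v)"
  proof
    assume "left_vertex G E1 C v \<and> right_vertex G E1 C v"
    then obtain z z' where z: "z \<in> set xs" "z \<in> C" "z' \<in> set ys" "z' \<in> C"
      using left_vertex_iff[OF assms(1) P] right_vertex_iff[OF assms(1) P] by blast
    then have "z = z'" using central_in_string_unique[OF assms(1) P, of z z'] by simp
    then show False using z c1.distinct_string[OF P] by auto
  qed
qed

lemma labels_exist:
  assumes "B1 G E1 C"
  shows "\<exists>l. labels_agree G E1 C l"
proof
  have "\<not> (left_vertex G E1 C v \<and> central_vertex G C v)"
    "\<not> (right_vertex G E1 C v \<and> central_vertex G C v)" for v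
    by (auto simp: left_vertex_def right_vertex_def central_vertex_def)
  then show "labels_agree G E1 C (\<lambda>v. if left_vertex G E1 C v then L0
      else if right_vertex G E1 C v then L1 else Lc)"
    using vertex_trichotomy[OF assms] unfolding labels_agree_def by auto
qed

lemma label_axioms_from_central:
  assumes B1: "B1 G E1 C" and B2: "B2 G E1 E2 C" and agree: "labels_agree G E1 C l"
  shows "label_axioms G E1 E2 l"
proof -
  have lab: "l v = L0 \<longleftrightarrow> left_vertex G E1 C v" "l v = Lc \<longleftrightarrow> central_vertex G C v"
    "l v = L1 \<longleftrightarrow> right_vertex G E1 C v" if "v \<in> verts G" for v
    using agree that by (auto simp: labels_agree_def)
  have "B1_i G E1 l"
    unfolding B1_i_def
  proof
    fix e assume e: "e \<in> E1"
    let ?t = "tail G e" and ?h = "head G e"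
    obtain xs ys where P: "xs @ Inl ?t # Inr e # Inl ?h # ys \<in> strings G E1"
      using c1.string_through_edge[OF e] by blast
    have h: "(xs @ [Inl ?t, Inr e]) @ Inl ?h # ys \<in> strings G E1" using P by simp
    have V: "?t \<in> verts G" "?h \<in> verts G" using c1.string_vertex[OF P] by auto
    obtain z where "z \<in> set (xs @ Inl ?t # Inr e # Inl ?h # ys)" "z \<in> C"
      using B1 P unfolding B1_def by blast
    \<comment> \<open>The five admissible pairs correspond to the five possible places of the central element.\<close>
    then consider (xs) "z \<in> set xs" | (t) "z = Inl ?t" | (e) "z = Inr e"
      | (h) "z = Inl ?h" | (ys) "z \<in> set ys" by auto
    then show "(l ?t, l ?h) \<in> {(L0, L0), (L0, Lc), (L0, L1), (Lc, L1), (L1, L1)}"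
    proof cases
      case xs
      then have "l ?t = L1" "l ?h = L1"
        using \<open>z \<in> C\<close> V lab right_vertex_iff[OF B1 P] right_vertex_iff[OF B1 h] by auto
      then show ?thesis by simp
    next
      case t
      then have "l ?t = Lc" "l ?h = L1"
        using \<open>z \<in> C\<close> V lab right_vertex_iff[OF B1 h] by (auto simp: central_vertex_def)
      then show ?thesis by simp
    next
      case e
      then have "l ?t = L0" "l ?h = L1"
        using \<open>z \<in> C\<close> V lab left_vertex_iff[OF B1 P] right_vertex_iff[OF B1 h] by auto
      then show ?thesis by simp
    next
      case h
      then have "l ?t = L0" "l ?h = Lc"
        using \<open>z \<in> C\<close> V lab left_vertex_iff[OF B1 P] by (auto simp: central_vertex_def)
      then show ?thesis by simp
    next
      case ys
      then have "l ?t = L0" "l ?h = L0"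
        using \<open>z \<in> C\<close> V lab left_vertex_iff[OF B1 P] left_vertex_iff[OF B1 h] by auto
      then show ?thesis by simp
    qed
  qed
  moreover have "B1_ii G E1 l"
    unfolding B1_ii_def
  proof (intro ballI conjI impI)
    fix v assume v: "v \<in> verts G"
    obtain xs ys where P: "xs @ Inl v # ys \<in> strings G E1"
      "in_arcs c1.H v = {} \<Longrightarrow> xs = []" "out_arcs c1.H v = {} \<Longrightarrow> ys = []"
      using c1.string_through_vertex[OF v] by blast
    show "l v \<noteq> L1" if "in_arcs c1.H v = {}"
      using P(2)[OF that] right_vertex_iff[OF B1 P(1)] lab[OF v] by simp
    show "l v \<noteq> L0" if "out_arcs c1.H v = {}"
      using P(3)[OF that] left_vertex_iff[OF B1 P(1)] lab[OF v] by simp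
  qed
  moreover
  have string2: "\<exists>xs w ys. P = xs @ Inl w # ys \<and> l w = Lc \<and>
      (\<forall>u. Inl u \<in> set xs \<longrightarrow> l u = L1) \<and> (\<forall>u. Inl u \<in> set ys \<longrightarrow> l u = L0)"
    if P: "P \<in> strings G E2" for P
  proof -
    obtain w where w: "Inl w \<in> set P" "central_vertex G C w"
      "\<And>u. lies_before P (Inl u) (Inl w) \<Longrightarrow> right_vertex G E1 C u"
      "\<And>u. lies_before P (Inl w) (Inl u) \<Longrightarrow> left_vertex G E1 C u"
      using B2 P unfolding B2_def by blast
    obtain xs ys where xy: "P = xs @ Inl w # ys" using w(1) by (auto dest: split_list)
    have d: "distinct (xs @ Inl w # ys)" using c2.distinct_string P xy by blast
    have "right_vertex G E1 C u" if "Inl u \<in> set xs" for u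
      using w(3) that unfolding xy lies_before_pivot_left[OF d] .
    moreover have "left_vertex G E1 C u" if "Inl u \<in> set ys" for u
      using w(4) that unfolding xy lies_before_pivot_right[OF d] .
    moreover have "u \<in> verts G" if "Inl u \<in> set P" for u
      using c2.string_vertex P that by blast
    ultimately show ?thesis using xy w(2) lab
      by (intro exI[of _ xs] exI[of _ w] exI[of _ ys]) auto
  qed
  have "B2_i G E2 l"
    unfolding B2_i_def
  proof
    fix e assume e: "e \<in> E2"
    let ?t = "tail G e" and ?h = "head G e"
    obtain as bs where P: "as @ Inl ?t # Inr e # Inl ?h # bs \<in> strings G E2"
      using c2.string_through_edge[OF e] by blast
    from string2[OF P] obtain xs w ys where
      eq: "as @ Inl ?t # Inr e # Inl ?h # bs = xs @ Inl w # ys" and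
      w: "l w = Lc" "\<forall>u. Inl u \<in> set xs \<longrightarrow> l u = L1" "\<forall>u. Inl u \<in> set ys \<longrightarrow> l u = L0"
      by blast
    \<comment> \<open>Being a vertex, the centre is not the edge itself, which leaves four places for it.\<close>
    from eq show "(l ?t, l ?h) \<in> {(L1, L1), (L1, Lc), (Lc, L0), (L0, L0)}"
      using w by (auto simp: append_eq_append_conv2 append_eq_Cons_conv Cons_eq_append_conv)
  qed
  moreover have "B2_ii G E2 l"
    unfolding B2_ii_def
  proof (intro ballI conjI impI)
    fix v assume v: "v \<in> verts G"
    obtain as bs where P: "as @ Inl v # bs \<in> strings G E2"
      "in_arcs c2.H v = {} \<Longrightarrow> as = []" "out_arcs c2.H v = {} \<Longrightarrow> bs = []"
      using c2.string_through_vertex[OF v] by blast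
    from string2[OF P(1)] obtain xs w ys where
      eq: "as @ Inl v # bs = xs @ Inl w # ys" and
      w: "l w = Lc" "\<forall>u. Inl u \<in> set xs \<longrightarrow> l u = L1" "\<forall>u. Inl u \<in> set ys \<longrightarrow> l u = L0"
      by blast
    show "l v \<noteq> L0" if "in_arcs c2.H v = {}"
      using P(2)[OF that] eq w by (auto simp: Cons_eq_append_conv)
    show "l v \<noteq> L1" if "out_arcs c2.H v = {}"
      using P(3)[OF that] eq w by (auto simp: append_eq_append_conv2 append_eq_Cons_conv Cons_eq_append_conv)
  qed
  ultimately show ?thesis by (simp add: label_axioms_def)
qed

section \<open>From labels to central elements\<close>

text \<open>The edge labels make \<open>Lc\<close> mark exactly the central elements: an edge jumping from \<open>L0\<close> to \<open>L1\<close>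
  gets \<open>Lc\<close>, and any other edge falls on the side of the switch where it lies.\<close>

lemma string1_phases:
  assumes "label_axioms G E1 E2 l" "P \<in> strings G E1"
  obtains xs z ys where "P = xs @ z # ys" "z \<in> central_elements G E1 l"
    "\<forall>t\<in>set xs \<union> set ys. t \<notin> central_elements G E1 l"
    "\<forall>v. Inl v \<in> set xs \<longrightarrow> l v = L0" "\<forall>v. Inl v \<in> set ys \<longrightarrow> l v = L1"
proof -
  define f where "f = case_sum l (\<lambda>e. if l (tail G e) \<noteq> L0 then L1
      else if l (head G e) = L1 then Lc else L0)"
  have B1i: "B1_i G E1 l" and B1ii: "B1_ii G E1 l"
    using assms(1) by (auto simp: label_axioms_def)
  have range: "k \<in> {L0, Lc} \<longleftrightarrow> k \<noteq> L1" "k \<in> {Lc, L1} \<longleftrightarrow> k \<noteq> L0" for k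
    by (cases k; simp)+
  have source: "f (Inl v) \<in> {L0, Lc}" if "v \<in> verts G" "in_arcs c1.H v = {}" for v
    using B1ii that unfolding range by (simp add: B1_ii_def f_def)
  have sink: "f (Inl v) \<in> {Lc, L1}" if "v \<in> verts G" "out_arcs c1.H v = {}" for v
    using B1ii that unfolding range by (simp add: B1_ii_def f_def)
  have step: "(f (Inl (tail G e)), f (Inr e), f (Inl (head G e)))
      \<in> {(L0, L0, L0), (L0, L0, Lc), (L0, Lc, L1), (Lc, L1, L1), (L1, L1, L1)}"
    if "e \<in> E1" for e
    using B1i[unfolded B1_i_def, rule_format, OF that] by (auto simp: f_def)
  obtain xs z ys where P: "P = xs @ z # ys" and
    f: "\<forall>t\<in>set xs. f t = L0" "f z = Lc" "\<forall>t\<in>set ys. f t = L1"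
    by (rule c1.string_two_phases[OF assms(2) label.distinct(1) label.distinct(3)
          label.distinct(5), of f, OF source sink step])
  have central: "t \<in> central_elements G E1 l \<longleftrightarrow> f t = Lc" if "t \<in> set P" for t
  proof (cases t)
    case (Inl v)
    then have "v \<in> verts G" using c1.string_vertex assms(2) that by blast
    then show ?thesis using Inl by (auto simp: central_elements_def f_def)
  next
    case (Inr e)
    then have "e \<in> E1" using c1.string_edge assms(2) that by blast
    then show ?thesis using Inr by (auto simp: central_elements_def f_def)
  qed
  show thesis
    using P f central by (intro that[of xs z ys]) (auto simp: f_def)
qed

text \<open>No 2-edge jumps from \<open>L1\<close> to \<open>L0\<close>, so edges need no label \<open>Lc\<close> and the switch has to be a vertex.\<close>

lemma string2_phases:
  assumes "label_axioms G E1 E2 l" "P \<in> strings G E2"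
  obtains xs w ys where "P = xs @ Inl w # ys" "l w = Lc"
    "\<forall>v. Inl v \<in> set xs \<longrightarrow> l v = L1" "\<forall>v. Inl v \<in> set ys \<longrightarrow> l v = L0"
proof -
  define f where "f = case_sum l (\<lambda>e. if l (tail G e) = L1 then L1 else L0)"
  have B2i: "B2_i G E2 l" and B2ii: "B2_ii G E2 l"
    using assms(1) by (auto simp: label_axioms_def)
  have range: "k \<in> {L1, Lc} \<longleftrightarrow> k \<noteq> L0" "k \<in> {Lc, L0} \<longleftrightarrow> k \<noteq> L1" for k
    by (cases k; simp)+
  have source: "f (Inl v) \<in> {L1, Lc}" if "v \<in> verts G" "in_arcs c2.H v = {}" for v
    using B2ii that unfolding range by (simp add: B2_ii_def f_def)
  have sink: "f (Inl v) \<in> {Lc, L0}" if "v \<in> verts G" "out_arcs c2.H v = {}" for v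
    using B2ii that unfolding range by (simp add: B2_ii_def f_def)
  have step: "(f (Inl (tail G e)), f (Inr e), f (Inl (head G e)))
      \<in> {(L1, L1, L1), (L1, L1, Lc), (L1, Lc, L0), (Lc, L0, L0), (L0, L0, L0)}"
    if "e \<in> E2" for e
    using B2i[unfolded B2_i_def, rule_format, OF that] by (auto simp: f_def)
  obtain xs z ys where P: "P = xs @ z # ys" and
    f: "\<forall>t\<in>set xs. f t = L1" "f z = Lc" "\<forall>t\<in>set ys. f t = L0"
    by (rule c2.string_two_phases[OF assms(2) label.distinct(6) label.distinct(4)
          label.distinct(2), of f, OF source sink step])
  obtain w where w: "z = Inl w" using f(2) by (cases z) (auto simp: f_def split: if_splits)
  have "l w = Lc" "\<forall>v. Inl v \<in> set xs \<longrightarrow> l v = L1" "\<forall>v. Inl v \<in> set ys \<longrightarrow> l v = L0"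
    using f w by (auto simp: f_def)
  moreover have "P = xs @ Inl w # ys" using P w by simp
  ultimately show thesis using that by blast
qed

lemma B1_from_labels:
  assumes "label_axioms G E1 E2 l"
  shows "B1 G E1 (central_elements G E1 l)"
  unfolding B1_def
proof
  fix P assume "P \<in> strings G E1"
  with assms obtain xs z ys where "P = xs @ z # ys" "z \<in> central_elements G E1 l"
    "\<forall>t\<in>set xs \<union> set ys. t \<notin> central_elements G E1 l"
    using string1_phases by metis
  then show "\<exists>!z. z \<in> set P \<and> z \<in> central_elements G E1 l" by (intro ex1I[of _ z]) auto
qed

lemma labels_agree_central_elements:
  assumes "label_axioms G E1 E2 l"
  shows "labels_agree G E1 (central_elements G E1 l) l"
proof -
  let ?C = "central_elements G E1 l"
  note B1 = B1_from_labels[OF assms]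
  have "(left_vertex G E1 ?C v \<longleftrightarrow> l v = L0) \<and> (central_vertex G ?C v \<longleftrightarrow> l v = Lc) \<and>
      (right_vertex G E1 ?C v \<longleftrightarrow> l v = L1)" if v: "v \<in> verts G" for v
  proof -
    obtain P where P: "P \<in> strings G E1" and in_P: "Inl v \<in> set P"
      using c1.string_through_vertex[OF v] by (metis in_set_conv_decomp)
    obtain xs z ys where
      eq: "P = xs @ z # ys" and z: "z \<in> ?C" and
      "\<forall>t\<in>set xs \<union> set ys. t \<notin> ?C" and
      l: "\<forall>v. Inl v \<in> set xs \<longrightarrow> l v = L0" "\<forall>v. Inl v \<in> set ys \<longrightarrow> l v = L1"
      by (rule string1_phases[OF assms P])
    have d: "distinct (xs @ z # ys)" using c1.distinct_string[OF P] eq by simp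
    have c: "central_vertex G ?C v \<longleftrightarrow> l v = Lc"
      using v by (auto simp: central_vertex_def central_elements_def)
    consider "Inl v \<in> set xs" | "Inl v = z" | "Inl v \<in> set ys"
      using in_P unfolding eq by auto
    then show ?thesis
    proof cases
      case 1
      then have "lies_before P (Inl v) z"
        unfolding eq lies_before_pivot_left[OF d] .
      then have "left_vertex G E1 ?C v"
        using v l(1) 1 z P c by (auto simp: left_vertex_def central_vertex_def)
      then show ?thesis using l(1) 1 vertex_trichotomy(2)[OF B1 v] c by auto
    next
      case 2
      then have "Inl v \<in> ?C" using z by simp
      then show ?thesis using c v
        by (auto simp: left_vertex_def right_vertex_def central_vertex_def)
    next
      case 3
      then have "lies_before P z (Inl v)"
        unfolding eq lies_before_pivot_right[OF d] .
      then have "right_vertex G E1 ?C v"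
        using v l(2) 3 z P c by (auto simp: right_vertex_def central_vertex_def)
      then show ?thesis using l(2) 3 vertex_trichotomy(2)[OF B1 v] c by auto
    qed
  qed
  then show ?thesis unfolding labels_agree_def by blast
qed

lemma B2_from_labels:
  assumes "label_axioms G E1 E2 l"
  shows "B2 G E1 E2 (central_elements G E1 l)"
  unfolding B2_def
proof
  let ?C = "central_elements G E1 l"
  fix P assume P: "P \<in> strings G E2"
  from string2_phases[OF assms P] obtain xs w ys where
    eq: "P = xs @ Inl w # ys" and w: "l w = Lc" and
    l: "\<forall>v. Inl v \<in> set xs \<longrightarrow> l v = L1" "\<forall>v. Inl v \<in> set ys \<longrightarrow> l v = L0" by blast
  have d: "distinct (xs @ Inl w # ys)" using c2.distinct_string[OF P] eq by simp
  have lab: "right_vertex G E1 ?C v \<longleftrightarrow> l v = L1" "left_vertex G E1 ?C v \<longleftrightarrow> l v = L0"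
    "central_vertex G ?C v \<longleftrightarrow> l v = Lc" if "Inl v \<in> set P" for v
    using labels_agree_central_elements[OF assms] c2.string_vertex[OF P that]
    by (auto simp: labels_agree_def)
  have "{v. Inl v \<in> set P \<and> central_vertex G ?C v} = {w}"
    using lab l w eq by fastforce
  moreover have "right_vertex G E1 ?C v" if "lies_before P (Inl v) (Inl w)" for v
    using that l(1) lab lies_before_pivot_left[OF d] eq by auto
  moreover have "left_vertex G E1 ?C v" if "lies_before P (Inl w) (Inl v)" for v
    using that l(2) lab lies_before_pivot_right[OF d] eq by auto
  ultimately show "\<exists>w. {v. Inl v \<in> set P \<and> central_vertex G ?C v} = {w} \<and>
      (\<forall>v. lies_before P (Inl v) (Inl w) \<longrightarrow> right_vertex G E1 ?C v) \<and>
      (\<forall>v. lies_before P (Inl w) (Inl v) \<longrightarrow> left_vertex G E1 ?C v)"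
    by (intro exI[of _ w]) blast
qed

end

section \<open>Equivalence of the two axiom systems\<close>

theorem mainTheorem1:
  fixes G :: "('a, 'b) pre_digraph" and E1 E2 :: "'b set"
  assumes "fin_digraph G"
    and "\<nexists>p. pre_digraph.cycle G p"
    and "arcs G = E1 \<union> E2" and "E1 \<inter> E2 = {}"
    and "B0 G E1" and "B0 G E2"
  shows
    "(\<forall>C. C \<subseteq> verts G <+> E1 \<and> B1 G E1 C \<and> B2 G E1 E2 C \<longrightarrow>
        (\<exists>l. labels_agree G E1 C l) \<and>
        (\<forall>l. labels_agree G E1 C l \<longrightarrow> label_axioms G E1 E2 l)) \<and>
     (\<forall>l. label_axioms G E1 E2 l \<longrightarrow>
        B1 G E1 (central_elements G E1 l) \<and>
        B2 G E1 E2 (central_elements G E1 l) \<and>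
        labels_agree G E1 (central_elements G E1 l) l)"
proof -
  have colour: "colour_class G F" if "F \<subseteq> arcs G" "B0 G F" for F
    using assms(1,2) that by (auto simp: colour_class_def colour_class_axioms_def)
  interpret two_coloured G E1 E2
    using colour assms(3,5,6) by (auto simp: two_coloured_def)
  show ?thesis
    using labels_exist label_axioms_from_central B1_from_labels B2_from_labels
      labels_agree_central_elements by blast
qed

end
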